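(* Let $(d_k)$ and $(N_k)$ be sequences of natural numbers such that $(d_k)$ is lacunary and $\sum_k\frac{d_k}{N_{k+a}}<\infty$ for some $a$. Then there is a constant $C\ge1$ such that for every $n$ and all trigonometric polynomials $\varphi_1,\dots,\varphi_n\in H^1(\mathbb{T})$ with $\varphi_k$ being $\frac{2\pi}{N_k}$-periodic and $\deg\varphi_k\le d_k$, \[C^{-1}\|(\varphi_k)_{k=1}^n\|_{\mathrm{ind}}\le\|(\varphi_k)_{k=1}^n\|_{L^1(\ell^2)}\le C\|(\varphi_k)_{k=1}^n\|_{\mathrm{ind}}.\]
   Context: $\mathbb{T}=\mathbb{R}/2\pi\mathbb{Z}$ with normalized Lebesgue measure $\mu$; $H^1(\mathbb{T})$ is the closed span in $L^1(\mathbb{T})$ of $e^{ijt}$, $j\ge0$. $(d_k)$ lacunary means $\inf_kd_{k+1}/d_k>1$. No divisibility relation between the $N_k$ is assumed. $\|(g_k)\|_{L^1(\ell^2)}=\int_{\mathbb{T}}(\sum_k|g_k|^2)^{1/2}d\mu$ and $\|(g_k)\|_{\mathrm{ind}}=\int_{\mathbb{T}^n}(\sum_k|g_k(t_k)|^2)^{1/2}d\mu(t_1)\cdots d\mu(t_n)$. *)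

theory Defs
  imports "HOL-Probability.Probability"
begin

text \<open>Sequences are indexed by k \<ge> 1. A sequence is lacunary if its terms are positive
  and the infimum of the successive ratios exceeds 1.\<close>
definition lacunary :: "(nat \<Rightarrow> nat) \<Rightarrow> bool" where
  "lacunary d \<longleftrightarrow> (\<forall>k\<ge>1. d k > 0) \<and>
     (INF k\<in>{1..}. real (d (Suc k)) / real (d k)) > 1"

text \<open>Functions on the torus are represented as functions on the reals (2 pi periodic).
  f is a trigonometric polynomial in H^1 of degree at most m.\<close>
definition trig_poly_H1 :: "nat \<Rightarrow> (real \<Rightarrow> complex) \<Rightarrow> bool" where
  "trig_poly_H1 m f \<longleftrightarrow>
     (\<exists>c :: nat \<Rightarrow> complex. \<forall>t. f t = (\<Sum>j\<le>m. c j * exp (\<i> * of_nat j * of_real t)))"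

definition torus_measure :: "real measure" where
  "torus_measure = uniform_measure lborel {0..2*pi}"

definition L1_l2_norm :: "(nat \<Rightarrow> real \<Rightarrow> complex) \<Rightarrow> nat \<Rightarrow> real" where
  "L1_l2_norm g n = (\<integral>t. sqrt (\<Sum>k\<in>{1..n}. (cmod (g k t))\<^sup>2) \<partial>torus_measure)"

definition ind_norm :: "(nat \<Rightarrow> real \<Rightarrow> complex) \<Rightarrow> nat \<Rightarrow> real" where
  "ind_norm g n = (\<integral>t. sqrt (\<Sum>k\<in>{1..n}. (cmod (g k (t k)))\<^sup>2)
      \<partial>(PiM {1..n} (\<lambda>_. torus_measure)))"

end

theory Submission
  imports Defs "HOL-Library.Real_Mod" "HOL-Library.Periodic_Fun"
begin

text \<open>
  Both norms of a family are, up to the factor \<open>a + 1\<close>, the sum of the norms of its subfamilies along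
  the residue classes modulo \<open>a + 1\<close>. Within a class the variables are separated one at a time,
  starting from the largest index \<open>m\<close>. Let \<open>F\<close> be the \<open>l\<^sup>2\<close>-valued polynomial of the terms that precede
  \<open>\<phi>\<^sub>m\<close>, of degree at most \<open>D = d (m - (a + 1))\<close>. Since \<open>\<phi>\<^sub>m\<close> has period \<open>2 \<pi> / N\<^sub>m\<close>, averaging over the
  translates \<open>t \<mapsto> t + u\<close> with \<open>0 \<le> u \<le> 2 \<pi> / N\<^sub>m\<close> makes \<open>\<phi>\<^sub>m (t + u)\<close> independent of \<open>t\<close>, while by a Bernstein
  inequality \<open>F (t + u)\<close> differs from \<open>F t\<close> by at most \<open>u D\<close> times the \<open>L\<^sup>1\<close>-norm of \<open>F\<close>. Each separation
  thus costs a factor \<open>1 + 2 \<pi> D / N\<^sub>m\<close>, and the product of these factors converges.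
\<close>

section \<open>A Bernstein inequality for translates\<close>

text \<open>Orthogonality of characters at \<open>M\<close> equidistant nodes: for \<open>q\<close>
  nonzero with |q| < M the ratio \<open>z\<close> of the geometric sum is an \<open>M\<close>-th
  root of unity other than 1.\<close>

lemma sum_cis_equidistant:
  fixes q :: int
  assumes "\<bar>q\<bar> < int M"
  shows "(\<Sum>m<M. cis (of_int q * (2 * pi * real m / real M))) = (if q = 0 then of_nat M else 0)"
proof (cases "q = 0")
  case False
  define z where "z = cis (of_int q * (2 * pi / real M))"
  have M: "M > 0" using assms by linarith
  have "z \<noteq> 1"
  proof
    assume "z = 1"
    then obtain n where "of_int q * (2 * pi / real M) = of_int n * (2 * pi)"
      unfolding z_def cis_eq_1_iff by blast
    then have "real_of_int q = of_int n * real M"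
      using M by (simp add: field_simps)
    then have "q = n * int M"
      by (metis of_int_eq_iff of_int_mult of_int_of_nat_eq)
    then show False
      using assms False by (auto simp: abs_mult)
  qed
  have "(\<Sum>m<M. cis (of_int q * (2 * pi * real m / real M))) = (\<Sum>m<M. z ^ m)"
    unfolding z_def Complex.DeMoivre by (intro sum.cong refl arg_cong[where f = cis]) simp
  also have "\<dots> = (z ^ M - 1) / (z - 1)"
    using \<open>z \<noteq> 1\<close> by (rule geometric_sum)
  also have "z ^ M = 1"
    unfolding z_def Complex.DeMoivre cis_eq_1_iff using M by (intro exI[of _ q]) simp
  finally show ?thesis using False by simp
qed simp

text \<open>Parseval at the nodes: after expanding the square, the frequencies \<open>l' - l\<close>
  are smaller than \<open>M\<close> in modulus, so only the \<open>D\<close> diagonal terms survive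
  and each contributes \<open>M\<close>.\<close>

lemma sum_norm_Dirichlet_sq:
  assumes "D \<le> M"
  shows "(\<Sum>m<M. (cmod (\<Sum>l<D. cis (real l * (v - 2 * pi * real m / real M))))\<^sup>2) = real M * real D"
proof -
  let ?y = "\<lambda>m. 2 * pi * real m / real M"
  have "complex_of_real (\<Sum>m<M. (cmod (\<Sum>l<D. cis (real l * (v - ?y m))))\<^sup>2)
      = (\<Sum>m<M. \<Sum>l<D. \<Sum>l'<D. cis (real l * (v - ?y m)) * cis (- (real l' * (v - ?y m))))"
    unfolding of_real_sum complex_norm_square cnj_sum cis_cnj sum_product ..
  also have "\<dots> = (\<Sum>m<M. \<Sum>l<D. \<Sum>l'<D. cis ((real l - real l') * v) * cis (of_int (int l' - int l) * ?y m))"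
    by (intro sum.cong refl) (simp add: cis_mult algebra_simps diff_divide_distrib)
  also have "\<dots> = (\<Sum>l<D. \<Sum>m<M. \<Sum>l'<D. cis ((real l - real l') * v) * cis (of_int (int l' - int l) * ?y m))"
    by (rule sum.swap)
  also have "\<dots> = (\<Sum>l<D. \<Sum>l'<D. \<Sum>m<M. cis ((real l - real l') * v) * cis (of_int (int l' - int l) * ?y m))"
    by (intro sum.cong refl sum.swap)
  also have "\<dots> = (\<Sum>l<D. \<Sum>l'<D. cis ((real l - real l') * v) * (if int l' - int l = 0 then of_nat M else 0))"
    unfolding sum_distrib_left[symmetric]
    by (intro sum.cong refl arg_cong2[where f = "(*)"] sum_cis_equidistant) (use assms in auto)
  also have "\<dots> = (\<Sum>l<D. \<Sum>l'<D. if l' = l then of_nat M else 0)"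
    by (intro sum.cong refl) auto
  also have "\<dots> = of_real (real M * real D)"
    by simp
  finally show ?thesis
    unfolding of_real_eq_iff .
qed

lemma cmod_cis_diff_le: "cmod (cis u - 1) \<le> \<bar>u\<bar>"
  using dist_exp_i_1[of u] abs_sin_x_le_abs_x[of "u / 2"] by (simp add: cis_conv_exp)

text \<open>
  With \<open>x\<^sub>m = 2 \<pi> m / (2 D + 1)\<close>, the weights are the values at \<open>- x\<^sub>m\<close> of
  \<open>(e\<^bsup>iu\<^esup> - 1) e\<^bsup>ix\<^esup> \<Delta>(x) \<Delta>(x + u) / (2 D + 1)\<close>, where \<open>\<Delta>(x) = \<Sum>\<^bsub>l<D\<^esub> e\<^bsup>ilx\<^esup>\<close>: for \<open>j \<le> D\<close> the \<open>j\<close>-th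
  Fourier coefficient of \<open>e\<^bsup>ix\<^esup> \<Delta>(x) \<Delta>(x + u)\<close> is \<open>\<Sum>\<^bsub>l<j\<^esub> e\<^bsup>ilu\<^esup> = (e\<^bsup>iju\<^esup> - 1) / (e\<^bsup>iu\<^esup> - 1)\<close>, and
  \<open>2 D + 1\<close> nodes are enough for the quadrature to be exact.
\<close>
lemma shift_difference_kernel:
  fixes u :: real and D :: nat
  obtains w :: "nat \<Rightarrow> complex"
  where "(\<Sum>m<2*D+1. cmod (w m)) \<le> \<bar>u\<bar> * real D"
    and "\<And>f t. trig_poly_H1 D f \<Longrightarrow>
      f (t + u) - f t = (\<Sum>m<2*D+1. w m * f (t + 2 * pi * real m / real (2*D+1)))"
proof -
  define M where "M = 2 * D + 1"
  define y where "y m = 2 * pi * real m / real M" for m :: nat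
  define A where "A m = (\<Sum>l<D. cis (real l * (u - y m)))" for m
  define B where "B m = (\<Sum>l<D. cis (real l * (0 - y m)))" for m
  define w where "w m = (cis u - 1) / of_nat M * cis (- y m) * A m * B m" for m
  have M: "M > 0" "D \<le> M" by (auto simp: M_def)
  \<comment> \<open>The product of the two Dirichlet sums is replaced by the mean of their squares.
    Each square can then be summed over the nodes by \<open>sum_norm_Dirichlet_sq\<close>, once with
    v = u and once with v = 0.\<close>
  have "cmod (w m) \<le> \<bar>u\<bar> / (2 * real M) * ((cmod (A m))\<^sup>2 + (cmod (B m))\<^sup>2)" for m
  proof -
    have "cmod (w m) = cmod (cis u - 1) / real M * (cmod (A m) * cmod (B m))"
      unfolding w_def by (simp add: norm_mult norm_divide)
    also have "\<dots> \<le> \<bar>u\<bar> / real M * (((cmod (A m))\<^sup>2 + (cmod (B m))\<^sup>2) / 2)"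
      using sum_squares_bound[of "cmod (A m)" "cmod (B m)"] cmod_cis_diff_le[of u]
      by (intro mult_mono divide_right_mono) auto
    finally show ?thesis by (simp add: field_simps)
  qed
  then have "(\<Sum>m<M. cmod (w m)) \<le>
      (\<Sum>m<M. \<bar>u\<bar> / (2 * real M) * ((cmod (A m))\<^sup>2 + (cmod (B m))\<^sup>2))"
    by (rule sum_mono)
  also have "\<dots> = \<bar>u\<bar> / (2 * real M) * (real M * real D + real M * real D)"
    unfolding sum_distrib_left[symmetric] sum.distrib A_def B_def y_def
      sum_norm_Dirichlet_sq[OF M(2)] ..
  also have "\<dots> = \<bar>u\<bar> * real D"
    using M by (simp add: field_simps)
  finally have bound: "(\<Sum>m<M. cmod (w m)) \<le> \<bar>u\<bar> * real D" .
  have monom: "(\<Sum>m<M. w m * cis (real j * (t + y m))) = cis (real j * (t + u)) - cis (real j * t)"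
    if "j \<le> D" for j t
  proof -
    have "(\<Sum>m<M. w m * cis (real j * (t + y m))) =
        (\<Sum>m<M. \<Sum>l<D. \<Sum>l'<D. (cis u - 1) / of_nat M * cis (real j * t) * cis (real l * u) *
           cis (of_int (int j - int l - int l' - 1) * y m))"
    proof (intro sum.cong refl)
      fix m
      have "w m * cis (real j * (t + y m)) =
          (cis u - 1) / of_nat M * (cis (- y m) * cis (real j * (t + y m))) * (A m * B m)"
        by (simp add: w_def)
      also have "\<dots> = (\<Sum>l<D. \<Sum>l'<D. (cis u - 1) / of_nat M * (cis (- y m) * cis (real j * (t + y m))) *
          (cis (real l * (u - y m)) * cis (real l' * (0 - y m))))"
        unfolding A_def B_def sum_product by (simp only: sum_distrib_left)
      also have "\<dots> = (\<Sum>l<D. \<Sum>l'<D. (cis u - 1) / of_nat M * cis (real j * t) * cis (real l * u) *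
           cis (of_int (int j - int l - int l' - 1) * y m))"
        unfolding mult.assoc cis_mult
        by (intro sum.cong refl arg_cong2[where f = "(*)"] arg_cong[where f = cis])
          (simp add: algebra_simps)
      finally show "w m * cis (real j * (t + y m)) = \<dots>" .
    qed
    also have "\<dots> = (\<Sum>l<D. \<Sum>m<M. \<Sum>l'<D. (cis u - 1) / of_nat M * cis (real j * t) * cis (real l * u) *
           cis (of_int (int j - int l - int l' - 1) * y m))"
      by (rule sum.swap)
    also have "\<dots> = (\<Sum>l<D. \<Sum>l'<D. \<Sum>m<M. (cis u - 1) / of_nat M * cis (real j * t) * cis (real l * u) *
           cis (of_int (int j - int l - int l' - 1) * y m))"
      by (intro sum.cong refl sum.swap)
    \<comment> \<open>For \<open>j\<close> at most \<open>D\<close> the frequency j - l - l' - 1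
      lies between -(2 D - 1) and D - 1, hence within the range where \<open>M\<close> nodes give
      orthogonality.\<close>
    also have "\<dots> = (\<Sum>l<D. \<Sum>l'<D. (cis u - 1) / of_nat M * cis (real j * t) * cis (real l * u) *
           (if int j - int l - int l' - 1 = 0 then of_nat M else 0))"
      unfolding sum_distrib_left[symmetric] y_def
      by (intro sum.cong refl arg_cong2[where f = "(*)"] sum_cis_equidistant)
        (use that in \<open>auto simp: M_def\<close>)
    also have "\<dots> = (\<Sum>l<D. if l < j then (cis u - 1) * cis (real j * t) * cis (real l * u) else 0)"
    proof (intro sum.cong refl)
      fix l
      \<comment> \<open>The surviving index is l' = j - 1 - l, which is below \<open>D\<close> since
        j is at most \<open>D\<close>. For l >= j truncated subtraction would produce the index 0;
        the inner conditional discards it.\<close>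
      have "(\<Sum>l'<D. (cis u - 1) / of_nat M * cis (real j * t) * cis (real l * u) *
           (if int j - int l - int l' - 1 = 0 then of_nat M else 0)) =
         (\<Sum>l'<D. if l' = j - 1 - l then
            (if l < j then (cis u - 1) * cis (real j * t) * cis (real l * u) else 0) else 0)"
        using M by (intro sum.cong refl) auto
      also have "\<dots> = (if l < j then (cis u - 1) * cis (real j * t) * cis (real l * u) else 0)"
        using that by (subst sum.delta) auto
      finally show "(\<Sum>l'<D. (cis u - 1) / of_nat M * cis (real j * t) * cis (real l * u) *
           (if int j - int l - int l' - 1 = 0 then of_nat M else 0)) = \<dots>" .
    qed
    also have "\<dots> = (\<Sum>l<j. (cis u - 1) * cis (real j * t) * cis (real l * u))"
      using that by (subst sum.inter_filter[symmetric]) (auto intro!: sum.cong)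
    \<comment> \<open>The factor e^(iu) - 1 built into the weights cancels the denominator of the
      geometric sum, so u in 2 pi Z needs no separate case.\<close>
    also have "\<dots> = cis (real j * t) * ((cis u - 1) * (\<Sum>l<j. cis u ^ l))"
      by (simp add: Complex.DeMoivre sum_distrib_left mult_ac)
    also have "(cis u - 1) * (\<Sum>l<j. cis u ^ l) = cis u ^ j - 1"
      by (rule power_diff_1_eq[symmetric])
    also have "cis (real j * t) * (cis u ^ j - 1) = cis (real j * (t + u)) - cis (real j * t)"
      by (simp add: Complex.DeMoivre cis_mult algebra_simps)
    finally show ?thesis .
  qed
  have repr: "f (t + u) - f t = (\<Sum>m<M. w m * f (t + y m))" if f: "trig_poly_H1 D f" for f t
  proof -
    obtain c where c: "f t = (\<Sum>j\<le>D. c j * cis (real j * t))" for t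
      using f unfolding trig_poly_H1_def cis_conv_exp by (auto simp: mult_ac)
    have "(\<Sum>m<M. w m * f (t + y m)) = (\<Sum>m<M. \<Sum>j\<le>D. c j * (w m * cis (real j * (t + y m))))"
      by (simp add: c sum_distrib_left mult_ac)
    also have "\<dots> = (\<Sum>j\<le>D. c j * (\<Sum>m<M. w m * cis (real j * (t + y m))))"
      unfolding sum_distrib_left by (rule sum.swap)
    also have "\<dots> = (\<Sum>j\<le>D. c j * (cis (real j * (t + u)) - cis (real j * t)))"
      by (intro sum.cong refl) (simp add: monom)
    also have "\<dots> = f (t + u) - f t"
      by (simp add: c algebra_simps sum_subtractf)
    finally show ?thesis ..
  qed
  show ?thesis
    using that[of w] bound repr unfolding M_def y_def by blast
qed

section \<open>Integration over the torus\<close>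

lemma sets_torus_measure [simp, measurable_cong]: "sets torus_measure = sets borel"
  by (simp add: torus_measure_def)

lemma space_torus_measure [simp]: "space torus_measure = UNIV"
  by (simp add: torus_measure_def)

interpretation torus: prob_space torus_measure
  unfolding torus_measure_def by (rule prob_space_uniform_measure) auto

text \<open>The end point is a null set. Half-open intervals can be cut and translated without
  overlaps.\<close>

lemma nn_integral_torus:
  assumes [measurable]: "f \<in> borel_measurable borel"
  shows "(\<integral>\<^sup>+t. f t \<partial>torus_measure) = (\<integral>\<^sup>+t. f t * indicator {0..<2*pi} t \<partial>lborel) / ennreal (2 * pi)"
proof -
  have "(\<integral>\<^sup>+t. f t * indicator {0..2*pi} t \<partial>lborel) = (\<integral>\<^sup>+t. f t * indicator {0..<2*pi} t \<partial>lborel)"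
    using AE_lborel_singleton[of "2 * pi"]
    by (intro nn_integral_cong_AE) (auto elim!: eventually_mono split: split_indicator)
  then show ?thesis
    unfolding torus_measure_def by (subst nn_integral_uniform_measure) auto
qed

lemma nn_integral_Ico_split:
  fixes a b c :: real
  assumes [measurable]: "f \<in> borel_measurable borel" and "a \<le> b" "b \<le> c"
  shows "(\<integral>\<^sup>+x. f x * indicator {a..<c} x \<partial>lborel) =
    (\<integral>\<^sup>+x. f x * indicator {a..<b} x \<partial>lborel) + (\<integral>\<^sup>+x. f x * indicator {b..<c} x \<partial>lborel)"
  using assms by (subst nn_integral_add[symmetric]) (auto intro!: nn_integral_cong split: split_indicator)

lemma nn_integral_Ico_shift:
  fixes a b T :: real
  assumes [measurable]: "f \<in> borel_measurable borel" and "\<And>x. f (x + T) = f x"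
  shows "(\<integral>\<^sup>+x. f x * indicator {a + T..<b + T} x \<partial>lborel) = (\<integral>\<^sup>+x. f x * indicator {a..<b} x \<partial>lborel)"
  using assms(2)
  by (subst nn_integral_real_affine[where c = 1 and t = T])
    (auto intro!: nn_integral_cong simp: add.commute[of T] split: split_indicator)

text \<open>A multiple of \<open>T\<close> moves the window to one starting at \<open>v\<close> in
  [0, T]; the part beyond \<open>T\<close> is then wrapped back to [0, v).\<close>

lemma nn_integral_period:
  fixes u T :: real
  assumes f [measurable]: "f \<in> borel_measurable borel" and per: "\<And>x. f (x + T) = f x" and "T > 0"
  shows "(\<integral>\<^sup>+x. f x * indicator {u..<u + T} x \<partial>lborel) = (\<integral>\<^sup>+x. f x * indicator {0..<T} x \<partial>lborel)"
proof -
  interpret periodic_fun_simple f T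
    by standard (rule per)
  define v where "v = u - of_int \<lfloor>u / T\<rfloor> * T"
  have v: "0 \<le> v" "v \<le> T"
    using \<open>T > 0\<close> floor_divide_lower[of T u] floor_divide_upper[of T u]
    by (auto simp: v_def algebra_simps)
  have "(\<integral>\<^sup>+x. f x * indicator {u..<u + T} x \<partial>lborel) = (\<integral>\<^sup>+x. f x * indicator {v..<v + T} x \<partial>lborel)"
    using nn_integral_Ico_shift[where f = f and T = "of_int \<lfloor>u / T\<rfloor> * T" and a = v and b = "v + T",
        OF f plus_of_int]
    by (simp add: v_def algebra_simps)
  also have "\<dots> = (\<integral>\<^sup>+x. f x * indicator {v..<T} x \<partial>lborel) + (\<integral>\<^sup>+x. f x * indicator {0 + T..<v + T} x \<partial>lborel)"
    using nn_integral_Ico_split[OF f, of v T "v + T"] v by simp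
  also have "\<dots> = (\<integral>\<^sup>+x. f x * indicator {0..<v} x \<partial>lborel) + (\<integral>\<^sup>+x. f x * indicator {v..<T} x \<partial>lborel)"
    unfolding nn_integral_Ico_shift[OF f per] by (rule add.commute)
  also have "\<dots> = (\<integral>\<^sup>+x. f x * indicator {0..<T} x \<partial>lborel)"
    using nn_integral_Ico_split[OF f, of 0 v T] v by simp
  finally show ?thesis .
qed

lemma nn_integral_torus_shift:
  assumes f [measurable]: "f \<in> borel_measurable borel" and per: "\<And>x. f (x + 2 * pi) = f x"
  shows "(\<integral>\<^sup>+t. f (t + u) \<partial>torus_measure) = (\<integral>\<^sup>+t. f t \<partial>torus_measure)"
proof -
  have "(\<integral>\<^sup>+t. f (t + u) * indicator {0..<2*pi} t \<partial>lborel) = (\<integral>\<^sup>+t. f t * indicator {u..<u + 2*pi} t \<partial>lborel)"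
    by (subst nn_integral_real_affine[where c = 1 and t = u and f = "\<lambda>t. f t * _ t"])
      (auto intro!: nn_integral_cong simp: add.commute[of u] split: split_indicator)
  also have "\<dots> = (\<integral>\<^sup>+t. f t * indicator {0..<2*pi} t \<partial>lborel)"
    by (rule nn_integral_period[OF f per]) simp
  finally show ?thesis
    by (simp add: nn_integral_torus)
qed

text \<open>The interval [0, 2 pi N) consists of \<open>N\<close> periods, and this factor cancels
  the Jacobian of the substitution.\<close>

lemma nn_integral_torus_dilate:
  assumes f [measurable]: "f \<in> borel_measurable borel" and per: "\<And>x. f (x + 2 * pi) = f x"
    and "N > 0"
  shows "(\<integral>\<^sup>+t. f (real N * t) \<partial>torus_measure) = (\<integral>\<^sup>+t. f t \<partial>torus_measure)"
proof -
  have *: "(\<integral>\<^sup>+t. f t * indicator {0..<real n * (2*pi)} t \<partial>lborel) =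
      of_nat n * (\<integral>\<^sup>+t. f t * indicator {0..<2*pi} t \<partial>lborel)" for n
  proof (induction n)
    case (Suc n)
    have "(\<integral>\<^sup>+t. f t * indicator {0..<real (Suc n) * (2*pi)} t \<partial>lborel) =
        (\<integral>\<^sup>+t. f t * indicator {0..<real n * (2*pi)} t \<partial>lborel) +
        (\<integral>\<^sup>+t. f t * indicator {real n * (2*pi)..<real n * (2 * pi) + 2*pi} t \<partial>lborel)"
      by (subst nn_integral_Ico_split[where b = "real n * (2*pi)"]) (auto simp: algebra_simps)
    then show ?case
      by (simp only: Suc nn_integral_period[OF f per] pi_gt_zero mult_pos_pos zero_less_numeral)
        (simp add: algebra_simps)
  qed simp
  have "of_nat N * (\<integral>\<^sup>+t. f t * indicator {0..<2*pi} t \<partial>lborel) =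
      ennreal \<bar>real N\<bar> * (\<integral>\<^sup>+t. f (real N * t) * indicator {0..<2*pi} t \<partial>lborel)"
    unfolding *[symmetric] using \<open>N > 0\<close>
    by (subst nn_integral_real_affine[where c = "real N" and t = 0])
      (auto intro!: nn_integral_cong arg_cong2[where f = "(*)"] simp: zero_le_mult_iff split: split_indicator)
  then have "(\<integral>\<^sup>+t. f t * indicator {0..<2*pi} t \<partial>lborel) =
      (\<integral>\<^sup>+t. f (real N * t) * indicator {0..<2*pi} t \<partial>lborel)"
    using \<open>N > 0\<close> by (simp add: ennreal_mult_cancel_left ennreal_of_nat_eq_real_of_nat)
  then show ?thesis
    by (simp add: nn_integral_torus)
qed

text \<open>In \<open>v\<close> the integrand has period 2 pi, so it may be dilated by
  \<open>N\<close>. This turns t + v / N into the translate t + v, and translation invariance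
  removes \<open>t\<close>.\<close>

lemma nn_integral_torus_period_average:
  assumes f [measurable]: "f \<in> borel_measurable borel" and per: "\<And>x. f (x + 2 * pi / real N) = f x"
    and "N > 0"
  shows "(\<integral>\<^sup>+v. f (t + v / real N) \<partial>torus_measure) = (\<integral>\<^sup>+s. f s \<partial>torus_measure)"
proof -
  interpret periodic_fun_simple f "2 * pi / real N"
    by standard (rule per)
  have per1: "f (t + (v + 2 * pi) / real N) = f (t + v / real N)" for v
    using per[of "t + v / real N"] by (simp add: add_divide_distrib add_ac)
  have per2: "f (x + 2 * pi) = f x" for x
    using plus_of_nat[of x N] \<open>N > 0\<close> by simp
  have "(\<integral>\<^sup>+v. f (t + v / real N) \<partial>torus_measure) = (\<integral>\<^sup>+v. f (t + real N * v / real N) \<partial>torus_measure)"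
    by (rule nn_integral_torus_dilate[symmetric, where f = "\<lambda>v. f (t + v / real N)"])
      (use per1 \<open>N > 0\<close> in auto)
  also have "\<dots> = (\<integral>\<^sup>+v. f (v + t) \<partial>torus_measure)"
    using \<open>N > 0\<close> by (simp add: add.commute)
  also have "\<dots> = (\<integral>\<^sup>+s. f s \<partial>torus_measure)"
    by (rule nn_integral_torus_shift[OF f per2])
  finally show ?thesis .
qed

section \<open>Separation of variables\<close>

lemma trig_poly_H1_mono:
  assumes "trig_poly_H1 m f" "m \<le> n"
  shows "trig_poly_H1 n f"
proof -
  obtain c where c: "f t = (\<Sum>j\<le>m. c j * exp (\<i> * of_nat j * of_real t))" for t
    using assms(1) unfolding trig_poly_H1_def by auto
  have "f t = (\<Sum>j\<le>n. (if j \<le> m then c j else 0) * exp (\<i> * of_nat j * of_real t))" for t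
    unfolding c by (rule sum.mono_neutral_cong_left) (use assms(2) in auto)
  then show ?thesis
    unfolding trig_poly_H1_def by (intro exI[of _ "\<lambda>j. if j \<le> m then c j else 0"]) blast
qed

lemma trig_poly_H1_measurable:
  assumes "trig_poly_H1 m f"
  shows "f \<in> borel_measurable borel"
proof -
  obtain c where c: "f = (\<lambda>t. \<Sum>j\<le>m. c j * exp (\<i> * of_nat j * of_real t))"
    using assms unfolding trig_poly_H1_def by auto
  show ?thesis
    unfolding c by (intro borel_measurable_continuous_onI continuous_intros)
qed

lemma trig_poly_H1_periodic:
  assumes "trig_poly_H1 m f"
  shows "f (t + 2 * pi) = f t"
proof -
  obtain c where c: "f t = (\<Sum>j\<le>m. c j * cis (real j * t))" for t
    using assms unfolding trig_poly_H1_def cis_conv_exp by (auto simp: mult_ac)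
  have "cis (real j * (t + 2 * pi)) = cis (real j * t)" for j
    using cis_multiple_2pi[of "real j"] by (simp add: distrib_left cis_mult[symmetric] mult_ac)
  then show ?thesis
    by (simp add: c)
qed

text \<open>Minkowski's inequality with weights common to all \<open>k\<close>: this carries the
  scalar kernel over to vector-valued polynomials without loss in the constant.\<close>

lemma L2_set_sum_mult_le:
  fixes w :: "nat \<Rightarrow> complex"
  shows "L2_set (\<lambda>k. cmod (\<Sum>m<M. w m * g m k)) K \<le> (\<Sum>m<M. cmod (w m) * L2_set (\<lambda>k. cmod (g m k)) K)"
proof (induction M)
  case (Suc M)
  have "L2_set (\<lambda>k. cmod (\<Sum>m<Suc M. w m * g m k)) K
      \<le> L2_set (\<lambda>k. cmod (\<Sum>m<M. w m * g m k) + cmod (w M) * cmod (g M k)) K"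
    by (intro L2_set_mono) (auto simp: norm_mult intro: order_trans[OF norm_triangle_ineq])
  also have "\<dots> \<le> L2_set (\<lambda>k. cmod (\<Sum>m<M. w m * g m k)) K + L2_set (\<lambda>k. cmod (w M) * cmod (g M k)) K"
    by (rule L2_set_triangle_ineq)
  finally show ?case
    using Suc by (simp add: L2_set_right_distrib)
qed (simp add: L2_set_def)

text \<open>This is the triangle inequality for vectors with an additional common coordinate
  sqrt(b), in which the difference vanishes. Later \<open>b\<close> holds the terms whose variables
  are already separated.\<close>

lemma sqrt_add_sum_squares_le:
  fixes x y :: "'a \<Rightarrow> complex"
  assumes "b \<ge> 0"
  shows "sqrt (b + (\<Sum>k\<in>K. (cmod (x k))\<^sup>2)) \<le>
    sqrt (b + (\<Sum>k\<in>K. (cmod (y k))\<^sup>2)) + L2_set (\<lambda>k. cmod (x k - y k)) K"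
proof -
  define X where "X = L2_set (\<lambda>k. cmod (x k)) K"
  define Y where "Y = L2_set (\<lambda>k. cmod (y k)) K"
  define Z where "Z = L2_set (\<lambda>k. cmod (x k - y k)) K"
  have nn: "X \<ge> 0" "Y \<ge> 0" "Z \<ge> 0"
    by (auto simp: X_def Y_def Z_def)
  have sq: "(\<Sum>k\<in>K. (cmod (x k))\<^sup>2) = X\<^sup>2" "(\<Sum>k\<in>K. (cmod (y k))\<^sup>2) = Y\<^sup>2"
    by (auto simp: X_def Y_def L2_set_def sum_nonneg)
  have "X \<le> L2_set (\<lambda>k. cmod (y k) + cmod (x k - y k)) K"
    unfolding X_def by (intro L2_set_mono) (auto simp: norm_triangle_sub)
  also have "\<dots> \<le> Y + Z"
    unfolding Y_def Z_def by (rule L2_set_triangle_ineq)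
  finally have "X\<^sup>2 \<le> (Y + Z)\<^sup>2"
    using nn by (intro power_mono) auto
  \<comment> \<open>Once both squares are expanded, only the cross terms remain to be
    compared.\<close>
  moreover have "Z * Y \<le> Z * sqrt (b + Y\<^sup>2)"
    using assms nn by (intro mult_left_mono real_le_rsqrt) auto
  moreover have "(sqrt (b + Y\<^sup>2))\<^sup>2 = b + Y\<^sup>2"
    using assms by simp
  ultimately have "b + X\<^sup>2 \<le> (sqrt (b + Y\<^sup>2) + Z)\<^sup>2"
    unfolding power2_sum by (simp add: algebra_simps)
  then show ?thesis
    unfolding sq Z_def[symmetric] using assms nn by (intro real_le_lsqrt) auto
qed

text \<open>The kernel writes the difference as a combination of translates, the same for every
  \<open>k\<close>. All translates have the same integral, so only the sum of the moduli of the
  weights enters.\<close>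

lemma nn_integral_shift_difference_le:
  assumes "\<And>k. k \<in> K \<Longrightarrow> trig_poly_H1 D (\<phi> k)"
  shows "(\<integral>\<^sup>+t. ennreal (L2_set (\<lambda>k. cmod (\<phi> k (t + u) - \<phi> k t)) K) \<partial>torus_measure)
    \<le> ennreal (\<bar>u\<bar> * real D) * (\<integral>\<^sup>+t. ennreal (L2_set (\<lambda>k. cmod (\<phi> k t)) K) \<partial>torus_measure)"
proof -
  obtain w where w: "(\<Sum>m<2*D+1. cmod (w m)) \<le> \<bar>u\<bar> * real D"
    "\<And>f t. trig_poly_H1 D f \<Longrightarrow>
      f (t + u) - f t = (\<Sum>m<2*D+1. w m * f (t + 2 * pi * real m / real (2*D+1)))"
    using shift_difference_kernel[of D u] by blast
  define M where "M = 2 * D + 1"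
  define y where "y m = 2 * pi * real m / real M" for m :: nat
  define F where "F t = ennreal (L2_set (\<lambda>k. cmod (\<phi> k t)) K)" for t
  have [measurable]: "\<phi> k \<in> borel_measurable borel" if "k \<in> K" for k
    using assms that by (blast intro: trig_poly_H1_measurable)
  have [measurable]: "F \<in> borel_measurable borel"
    unfolding F_def L2_set_def by measurable
  have F_per: "F (t + 2 * pi) = F t" for t
    unfolding F_def
    by (intro arg_cong[where f = ennreal] L2_set_cong) (auto simp: trig_poly_H1_periodic[OF assms])
  have "ennreal (L2_set (\<lambda>k. cmod (\<phi> k (t + u) - \<phi> k t)) K) \<le> (\<Sum>m<M. ennreal (cmod (w m)) * F (t + y m))" for t
  proof -
    have "L2_set (\<lambda>k. cmod (\<phi> k (t + u) - \<phi> k t)) K = L2_set (\<lambda>k. cmod (\<Sum>m<M. w m * \<phi> k (t + y m))) K"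
      unfolding M_def y_def using assms by (intro L2_set_cong refl arg_cong[where f = cmod] w(2))
    also have "\<dots> \<le> (\<Sum>m<M. cmod (w m) * L2_set (\<lambda>k. cmod (\<phi> k (t + y m))) K)"
      by (rule L2_set_sum_mult_le)
    finally show ?thesis
      unfolding F_def by (simp add: ennreal_mult'[symmetric] ennreal_leI)
  qed
  then have "(\<integral>\<^sup>+t. ennreal (L2_set (\<lambda>k. cmod (\<phi> k (t + u) - \<phi> k t)) K) \<partial>torus_measure)
      \<le> (\<integral>\<^sup>+t. (\<Sum>m<M. ennreal (cmod (w m)) * F (t + y m)) \<partial>torus_measure)"
    by (intro nn_integral_mono)
  also have "\<dots> = (\<Sum>m<M. ennreal (cmod (w m)) * (\<integral>\<^sup>+t. F (t + y m) \<partial>torus_measure))"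
    by (simp add: nn_integral_sum nn_integral_cmult)
  also have "\<dots> = ennreal (\<Sum>m<M. cmod (w m)) * (\<integral>\<^sup>+t. F t \<partial>torus_measure)"
    by (simp add: nn_integral_torus_shift F_per sum_distrib_right[symmetric])
  also have "\<dots> \<le> ennreal (\<bar>u\<bar> * real D) * (\<integral>\<^sup>+t. F t \<partial>torus_measure)"
    unfolding M_def by (intro mult_right_mono ennreal_leI w(1)) simp
  finally show ?thesis
    unfolding F_def .
qed

text \<open>Both integrals are averages over u = v / N, of \<open>Q (t + u) (t + u)\<close> by
  translation invariance and of \<open>Q t (t + u)\<close> by periodicity of \<open>h\<close>. The
  integrands differ by at most \<open>E u t\<close>. Its average is at most 2 pi D / N times the
  integral of \<open>F\<close>, which \<open>F\<close> <= \<open>Q\<close> absorbs into either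
  side.\<close>

lemma decouple_periodic:
  fixes h :: "real \<Rightarrow> complex"
  assumes \<phi>: "\<And>k. k \<in> K \<Longrightarrow> trig_poly_H1 D (\<phi> k)"
    and h [measurable]: "h \<in> borel_measurable borel"
    and per: "\<And>t. h (t + 2 * pi / real N) = h t" and "N > 0" and "b \<ge> 0"
  defines "Q \<equiv> \<lambda>t s. ennreal (sqrt (b + (cmod (h s))\<^sup>2 + (\<Sum>k\<in>K. (cmod (\<phi> k t))\<^sup>2)))"
    and "c \<equiv> ennreal (1 + 2 * pi * real D / real N)"
  shows "(\<integral>\<^sup>+t. Q t t \<partial>torus_measure) \<le> c * (\<integral>\<^sup>+s. \<integral>\<^sup>+t. Q t s \<partial>torus_measure \<partial>torus_measure)"
    and "(\<integral>\<^sup>+s. \<integral>\<^sup>+t. Q t s \<partial>torus_measure \<partial>torus_measure) \<le> c * (\<integral>\<^sup>+t. Q t t \<partial>torus_measure)"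
proof -
  interpret pair_sigma_finite torus_measure torus_measure ..
  define F where "F t = ennreal (L2_set (\<lambda>k. cmod (\<phi> k t)) K)" for t
  define E where "E u t = ennreal (L2_set (\<lambda>k. cmod (\<phi> k (t + u) - \<phi> k t)) K)" for u t
  have [measurable]: "\<phi> k \<in> borel_measurable borel" if "k \<in> K" for k
    using \<phi> that by (blast intro: trig_poly_H1_measurable)
  have Q [measurable]: "case_prod Q \<in> borel_measurable (borel \<Otimes>\<^sub>M borel)"
    unfolding Q_def by measurable
  have E [measurable]: "case_prod E \<in> borel_measurable (borel \<Otimes>\<^sub>M borel)"
    unfolding E_def L2_set_def by measurable
  have h_per: "h (t + 2 * pi) = h t" for t
  proof -
    interpret periodic_fun_simple h "2 * pi / real N"
      by standard (rule per)
    show ?thesis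
      using plus_of_nat[of t N] \<open>N > 0\<close> by simp
  qed
  have Q_per: "Q (t + 2 * pi) (t + 2 * pi) = Q t t" for t
    unfolding Q_def by (simp add: h_per trig_poly_H1_periodic[OF \<phi>])
  have diag: "(\<integral>\<^sup>+t. Q t t \<partial>torus_measure) =
      (\<integral>\<^sup>+v. \<integral>\<^sup>+t. Q (t + v / real N) (t + v / real N) \<partial>torus_measure \<partial>torus_measure)"
    by (subst nn_integral_torus_shift[where f = "\<lambda>t. Q t t"])
      (auto simp: Q_per torus.emeasure_space_1[simplified])
  have "(\<integral>\<^sup>+s. \<integral>\<^sup>+t. Q t s \<partial>torus_measure \<partial>torus_measure) =
      (\<integral>\<^sup>+t. \<integral>\<^sup>+s. Q t s \<partial>torus_measure \<partial>torus_measure)"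
    by (rule Fubini') simp
  \<comment> \<open>With \<open>t\<close> fixed, \<open>s\<close> occurs only through
    \<open>h\<close>, so its average may be taken over the points t + v / N instead.\<close>
  also have "\<dots> = (\<integral>\<^sup>+t. \<integral>\<^sup>+v. Q t (t + v / real N) \<partial>torus_measure \<partial>torus_measure)"
    using \<open>N > 0\<close>
    by (intro nn_integral_cong nn_integral_torus_period_average[symmetric]) (auto simp: Q_def per)
  also have "\<dots> = (\<integral>\<^sup>+v. \<integral>\<^sup>+t. Q t (t + v / real N) \<partial>torus_measure \<partial>torus_measure)"
    by (rule Fubini'[symmetric]) simp
  finally have indep: "(\<integral>\<^sup>+s. \<integral>\<^sup>+t. Q t s \<partial>torus_measure \<partial>torus_measure) = \<dots>" .
  have "(\<integral>\<^sup>+v. \<integral>\<^sup>+t. E (v / real N) t \<partial>torus_measure \<partial>torus_measure) \<le>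
      (\<integral>\<^sup>+v. ennreal (2 * pi * real D / real N) * (\<integral>\<^sup>+t. F t \<partial>torus_measure) \<partial>torus_measure)"
  proof (rule nn_integral_mono_AE)
    \<comment> \<open>The measure lives on the whole line, so v <= 2 pi holds only almost
      everywhere; it yields |v / N| D <= 2 pi D / N.\<close>
    have "AE v in torus_measure. v \<in> {0..2*pi}"
      unfolding torus_measure_def by (rule AE_uniform_measureI) auto
    then show "AE v in torus_measure. (\<integral>\<^sup>+t. E (v / real N) t \<partial>torus_measure) \<le>
        ennreal (2 * pi * real D / real N) * (\<integral>\<^sup>+t. F t \<partial>torus_measure)"
    proof eventually_elim
      case (elim v)
      have "(\<integral>\<^sup>+t. E (v / real N) t \<partial>torus_measure) \<le>
          ennreal (\<bar>v / real N\<bar> * real D) * (\<integral>\<^sup>+t. F t \<partial>torus_measure)"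
        unfolding E_def F_def by (rule nn_integral_shift_difference_le[OF \<phi>])
      also have "\<dots> \<le> ennreal (2 * pi * real D / real N) * (\<integral>\<^sup>+t. F t \<partial>torus_measure)"
        using elim by (intro mult_right_mono ennreal_leI) (auto simp: divide_right_mono mult_right_mono)
      finally show ?case .
    qed
  qed
  then have err: "(\<integral>\<^sup>+v. \<integral>\<^sup>+t. E (v / real N) t \<partial>torus_measure \<partial>torus_measure) \<le>
      ennreal (2 * pi * real D / real N) * (\<integral>\<^sup>+t. F t \<partial>torus_measure)"
    by (simp add: torus.emeasure_space_1[simplified])
  have FQ: "F t \<le> Q t s" for t s
    unfolding F_def Q_def L2_set_def using \<open>b \<ge> 0\<close> by (intro ennreal_leI real_sqrt_le_mono) simp
  have c: "c * x = x + ennreal (2 * pi * real D / real N) * x" for x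
    unfolding c_def by (subst ennreal_plus) (auto simp: distrib_right)
  have "Q (t + u) (t + u) \<le> Q t (t + u) + E u t" for t u
    unfolding Q_def E_def using \<open>b \<ge> 0\<close>
    by (subst ennreal_plus[symmetric])
      (auto intro!: ennreal_leI sqrt_add_sum_squares_le add_nonneg_nonneg sum_nonneg)
  then have "(\<integral>\<^sup>+t. Q t t \<partial>torus_measure) \<le>
      (\<integral>\<^sup>+v. \<integral>\<^sup>+t. Q t (t + v / real N) + E (v / real N) t \<partial>torus_measure \<partial>torus_measure)"
    unfolding diag by (intro nn_integral_mono)
  also have "\<dots> = (\<integral>\<^sup>+s. \<integral>\<^sup>+t. Q t s \<partial>torus_measure \<partial>torus_measure) +
      (\<integral>\<^sup>+v. \<integral>\<^sup>+t. E (v / real N) t \<partial>torus_measure \<partial>torus_measure)"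
    unfolding indep by (simp add: nn_integral_add)
  also have "\<dots> \<le> c * (\<integral>\<^sup>+s. \<integral>\<^sup>+t. Q t s \<partial>torus_measure \<partial>torus_measure)"
  proof -
    have "(\<integral>\<^sup>+t. F t \<partial>torus_measure) = (\<integral>\<^sup>+s. \<integral>\<^sup>+t. F t \<partial>torus_measure \<partial>torus_measure)"
      by (simp add: torus.emeasure_space_1[simplified])
    also have "\<dots> \<le> (\<integral>\<^sup>+s. \<integral>\<^sup>+t. Q t s \<partial>torus_measure \<partial>torus_measure)"
      by (intro nn_integral_mono FQ)
    finally show ?thesis
      unfolding c by (intro add_left_mono order_trans[OF err] mult_left_mono) auto
  qed
  finally show "(\<integral>\<^sup>+t. Q t t \<partial>torus_measure) \<le> c * (\<integral>\<^sup>+s. \<integral>\<^sup>+t. Q t s \<partial>torus_measure \<partial>torus_measure)" .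
  have "Q t (t + u) \<le> Q (t + u) (t + u) + E u t" for t u
    unfolding Q_def E_def norm_minus_commute[of "\<phi> _ (t + u)"] using \<open>b \<ge> 0\<close>
    by (subst ennreal_plus[symmetric])
      (auto intro!: ennreal_leI sqrt_add_sum_squares_le add_nonneg_nonneg sum_nonneg)
  then have "(\<integral>\<^sup>+s. \<integral>\<^sup>+t. Q t s \<partial>torus_measure \<partial>torus_measure) \<le>
      (\<integral>\<^sup>+v. \<integral>\<^sup>+t. Q (t + v / real N) (t + v / real N) + E (v / real N) t \<partial>torus_measure \<partial>torus_measure)"
    unfolding indep by (intro nn_integral_mono)
  also have "\<dots> = (\<integral>\<^sup>+t. Q t t \<partial>torus_measure) +
      (\<integral>\<^sup>+v. \<integral>\<^sup>+t. E (v / real N) t \<partial>torus_measure \<partial>torus_measure)"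
    unfolding diag by (simp add: nn_integral_add)
  also have "\<dots> \<le> c * (\<integral>\<^sup>+t. Q t t \<partial>torus_measure)"
    unfolding c by (intro add_left_mono order_trans[OF err] mult_left_mono nn_integral_mono FQ) auto
  finally show "(\<integral>\<^sup>+s. \<integral>\<^sup>+t. Q t s \<partial>torus_measure \<partial>torus_measure) \<le> c * (\<integral>\<^sup>+t. Q t t \<partial>torus_measure)" .
qed

interpretation torus_product: product_prob_space "\<lambda>_ :: nat. torus_measure" UNIV
  by standard

text \<open>Induction on the largest index \<open>m\<close>: all remaining terms then have degree at
  most \<open>D m\<close>, as \<open>decouple_periodic\<close> requires. The separated term is a
  constant for the remaining variables and joins \<open>b\<close>, which is why \<open>b\<close> is
  arbitrary.\<close>

lemma diagonal_equiv_independent: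
  fixes N D :: "nat \<Rightarrow> nat" and \<phi> :: "nat \<Rightarrow> real \<Rightarrow> complex"
  assumes "finite K" and "b \<ge> 0"
    and "\<And>m. m \<in> K \<Longrightarrow> N m > 0"
    and "\<And>m t. m \<in> K \<Longrightarrow> \<phi> m (t + 2 * pi / real (N m)) = \<phi> m t"
    and "\<And>m. m \<in> K \<Longrightarrow> \<phi> m \<in> borel_measurable borel"
    and "\<And>i m. i \<in> K \<Longrightarrow> m \<in> K \<Longrightarrow> i < m \<Longrightarrow> trig_poly_H1 (D m) (\<phi> i)"
  defines "J \<equiv> \<lambda>K b. \<integral>\<^sup>+t. ennreal (sqrt (b + (\<Sum>k\<in>K. (cmod (\<phi> k t))\<^sup>2))) \<partial>torus_measure"
    and "I \<equiv> \<lambda>K b. \<integral>\<^sup>+t. ennreal (sqrt (b + (\<Sum>k\<in>K. (cmod (\<phi> k (t k)))\<^sup>2))) \<partial>PiM K (\<lambda>_. torus_measure)"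
    and "P \<equiv> \<lambda>K. ennreal (\<Prod>m\<in>K. 1 + 2 * pi * real (D m) / real (N m))"
  shows "J K b \<le> P K * I K b \<and> I K b \<le> P K * J K b"
  using assms(1-6)
proof (induction K arbitrary: b rule: finite_linorder_max_induct)
  case empty
  interpret P: prob_space "PiM {} (\<lambda>_ :: nat. torus_measure)"
    by (rule prob_space_PiM) (rule torus.prob_space_axioms)
  show ?case
    unfolding J_def I_def P_def
    by (simp add: torus.emeasure_space_1[simplified] P.emeasure_space_1)
next
  case (insert m K)
  note [measurable] = insert.prems(4)
  interpret P: prob_space "PiM K (\<lambda>_ :: nat. torus_measure)"
    by (rule prob_space_PiM) (rule torus.prob_space_axioms)
  have m: "m \<notin> K" using insert.hyps by auto
  define c where "c = ennreal (1 + 2 * pi * real (D m) / real (N m))"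
  let ?B = "\<lambda>s. b + (cmod (\<phi> m s))\<^sup>2"
  have P_insert: "P (insert m K) = c * P K"
    unfolding P_def c_def using m insert.hyps(1)
    by (simp add: ennreal_mult'' prod_nonneg)
  have J_insert: "J (insert m K) b = (\<integral>\<^sup>+t. ennreal (sqrt (?B t + (\<Sum>k\<in>K. (cmod (\<phi> k t))\<^sup>2))) \<partial>torus_measure)"
    unfolding J_def using m insert.hyps(1) by (simp add: add.assoc)
  have I_insert: "I (insert m K) b = (\<integral>\<^sup>+s. I K (?B s) \<partial>torus_measure)"
    unfolding I_def
  proof (subst torus_product.product_nn_integral_insert_rev[OF insert.hyps(1) m])
    show "(\<integral>\<^sup>+s. \<integral>\<^sup>+t. ennreal (sqrt (b + (\<Sum>k\<in>insert m K. (cmod (\<phi> k ((t(m := s)) k)))\<^sup>2)))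
        \<partial>PiM K (\<lambda>_. torus_measure) \<partial>torus_measure) =
      (\<integral>\<^sup>+s. \<integral>\<^sup>+t. ennreal (sqrt (?B s + (\<Sum>k\<in>K. (cmod (\<phi> k (t k)))\<^sup>2)))
        \<partial>PiM K (\<lambda>_. torus_measure) \<partial>torus_measure)"
    proof (intro nn_integral_cong arg_cong[where f = "\<lambda>x. ennreal (sqrt x)"])
      fix s :: real and t :: "nat \<Rightarrow> real"
      have "(\<Sum>k\<in>K. (cmod (\<phi> k ((t(m := s)) k)))\<^sup>2) = (\<Sum>k\<in>K. (cmod (\<phi> k (t k)))\<^sup>2)"
        using m by (intro sum.cong) auto
      then show "b + (\<Sum>k\<in>insert m K. (cmod (\<phi> k ((t(m := s)) k)))\<^sup>2) =
          ?B s + (\<Sum>k\<in>K. (cmod (\<phi> k (t k)))\<^sup>2)"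
        using m insert.hyps(1) by (simp add: add.assoc)
    qed
  qed measurable
  have [measurable]: "(\<lambda>s. J K (?B s)) \<in> borel_measurable borel" "(\<lambda>s. I K (?B s)) \<in> borel_measurable borel"
    unfolding J_def I_def by measurable
  \<comment> \<open>The separated variable \<open>s\<close> is frozen here; integrating these bounds
    over \<open>s\<close> brings back the full product measure through
    \<open>I_insert\<close>.\<close>
  have IH: "J K (?B s) \<le> P K * I K (?B s)" "I K (?B s) \<le> P K * J K (?B s)" for s
    using insert.IH[of "?B s"] insert.prems by auto
  have poly: "trig_poly_H1 (D m) (\<phi> k)" if "k \<in> K" for k
    using insert.prems(5)[of k m] insert.hyps(2) that by auto
  have decouple: "J (insert m K) b \<le> c * (\<integral>\<^sup>+s. J K (?B s) \<partial>torus_measure)"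
    "(\<integral>\<^sup>+s. J K (?B s) \<partial>torus_measure) \<le> c * J (insert m K) b"
    unfolding J_insert c_def unfolding J_def
    by (rule decouple_periodic[OF poly]; use insert.prems in auto)+
  have "(\<integral>\<^sup>+s. J K (?B s) \<partial>torus_measure) \<le> (\<integral>\<^sup>+s. P K * I K (?B s) \<partial>torus_measure)"
    by (intro nn_integral_mono IH)
  then have "(\<integral>\<^sup>+s. J K (?B s) \<partial>torus_measure) \<le> P K * I (insert m K) b"
    by (simp add: nn_integral_cmult I_insert)
  then have 1: "J (insert m K) b \<le> c * (P K * I (insert m K) b)"
    by (intro order_trans[OF decouple(1)] mult_left_mono) auto
  have "I (insert m K) b \<le> (\<integral>\<^sup>+s. P K * J K (?B s) \<partial>torus_measure)"
    unfolding I_insert by (intro nn_integral_mono IH)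
  also have "\<dots> = P K * (\<integral>\<^sup>+s. J K (?B s) \<partial>torus_measure)"
    by (simp add: nn_integral_cmult)
  also have "\<dots> \<le> P K * (c * J (insert m K) b)"
    by (intro mult_left_mono decouple) auto
  finally show ?case
    using 1 unfolding P_insert by (simp add: mult_ac)
qed

section \<open>Reduction to residue classes and the final constant\<close>

lemma lacunary_mono:
  assumes "lacunary d" "1 \<le> i" "i \<le> j"
  shows "d i \<le> d j"
proof -
  have step_le: "d k \<le> d (Suc k)" if "k \<ge> 1" for k
  proof -
    have "1 < (INF k\<in>{1..}. real (d (Suc k)) / real (d k))" and "d k > 0"
      using assms(1) that by (auto simp: lacunary_def)
    moreover have "(INF k\<in>{1..}. real (d (Suc k)) / real (d k)) \<le> real (d (Suc k)) / real (d k)"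
      using that by (intro cINF_lower bdd_belowI2[of _ 0]) auto
    ultimately have "1 < real (d (Suc k)) / real (d k)"
      by linarith
    then show ?thesis
      using \<open>d k > 0\<close> by (simp add: field_simps)
  qed
  show ?thesis
    using assms(3)
  proof (induction rule: dec_induct)
    case (step j)
    then show ?case
      using \<open>1 \<le> i\<close> step_le by (meson order_trans)
  qed simp
qed

text \<open>Since \<open>enn2real\<close> sends infinity to 0, it does not preserve inequalities in
  general. The two-sided comparison forces both quantities to be infinite together, and then both
  values are 0.\<close>

lemma enn2real_equiv:
  assumes "x \<le> ennreal C * y" "y \<le> ennreal C * x" "C \<ge> 1"
  shows "enn2real y / C \<le> enn2real x" "enn2real x \<le> C * enn2real y"
proof -
  have "enn2real v \<le> C * enn2real u" if "u \<le> ennreal C * v" "v \<le> ennreal C * u" for u v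
  proof (cases "u = \<infinity>")
    case True
    then have "v = \<infinity>"
      using that(1) by (auto simp: top_unique ennreal_mult_eq_top_iff)
    with True show ?thesis by simp
  next
    case False
    then have "enn2real v \<le> enn2real (ennreal C * u)"
      using that(2) by (intro enn2real_mono) (auto simp: ennreal_mult_less_top less_top)
    then show ?thesis
      using \<open>C \<ge> 1\<close> by (simp add: enn2real_mult)
  qed
  from this[of x y] this[of y x] show "enn2real y / C \<le> enn2real x" "enn2real x \<le> C * enn2real y"
    using assms by (auto simp: field_simps)
qed

text \<open>The square root is subadditive, and the fibres of \<open>g\<close> partition
  \<open>A\<close>. It serves to split a norm along residue classes.\<close>

lemma sqrt_sum_le_sum_fibres:
  fixes f :: "'a \<Rightarrow> real"
  assumes "finite A" "finite R" "\<And>k. f k \<ge> 0" "g ` A \<subseteq> R"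
  shows "sqrt (\<Sum>k\<in>A. f k) \<le> (\<Sum>r\<in>R. sqrt (\<Sum>k\<in>{k\<in>A. g k = r}. f k))"
proof -
  have "(\<Sum>k\<in>A. f k) = (\<Sum>r\<in>R. \<Sum>k\<in>{k\<in>A. g k = r}. f k)"
    using assms by (intro sum.group[symmetric]) auto
  moreover have "sqrt (\<Sum>r\<in>R. h r) \<le> (\<Sum>r\<in>R. sqrt (h r))" if "\<And>r. h r \<ge> 0" for h :: "_ \<Rightarrow> real"
    using assms(2)
  proof (induction R rule: finite_induct)
    case (insert r R)
    have "sqrt (h r + (\<Sum>r\<in>R. h r)) \<le> sqrt (h r) + sqrt (\<Sum>r\<in>R. h r)"
      by (intro sqrt_add_le_add_sqrt sum_nonneg that)
    then show ?case
      using insert by simp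
  qed simp
  ultimately show ?thesis
    using assms(3) by (simp add: sum_nonneg)
qed

theorem theorem2p9:
  fixes d N :: "nat \<Rightarrow> nat" and a :: nat
  assumes "lacunary d"
    and "\<forall>k\<ge>1. N k > 0"
    and "summable (\<lambda>k. real (d k) / real (N (k + a)))"
  shows "\<exists>C::real. C \<ge> 1 \<and>
    (\<forall>(n::nat) (\<phi>::nat \<Rightarrow> real \<Rightarrow> complex).
       (\<forall>k\<in>{1..n}. trig_poly_H1 (d k) (\<phi> k) \<and>
          (\<forall>t. \<phi> k (t + 2 * pi / real (N k)) = \<phi> k t)) \<longrightarrow>
       ind_norm \<phi> n / C \<le> L1_l2_norm \<phi> n \<and> L1_l2_norm \<phi> n \<le> C * ind_norm \<phi> n)"
proof -
  \<comment> \<open>Working with \<open>a + 1\<close> covers the case \<open>a = 0\<close>; since \<open>d\<close> increases, the series stays summable.\<close>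
  define p where "p = Suc a"
  define S where "S = (\<Sum>k. real (d k) / real (N (k + a)))"
  \<comment> \<open>An earlier index in the residue class of \<open>m\<close> modulo
    \<open>p\<close> is at most m - p, so d (m - p) bounds its degree. For m <= p there is no such
    index, and the value 0 makes the separation factor 1.\<close>
  define D where "D m = (if m > p then d (m - p) else 0)" for m
  \<comment> \<open>The exponential bounds the product of the separation factors through 1 + x <=
    e^x; the factor \<open>p\<close> counts the residue classes.\<close>
  define C where "C = real p * exp (2 * pi * S)"
  have "S \<ge> 0"
    unfolding S_def by (intro suminf_nonneg assms(3)) simp
  then have "C \<ge> 1"
    using mult_mono[of 1 "real p" 1 "exp (2 * pi * S)"] by (simp add: C_def p_def)
  have sum_le: "(\<Sum>m\<in>K. real (D m) / real (N m)) \<le> S" if "finite K" for K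
  proof -
    have "(\<Sum>m\<in>K. real (D m) / real (N m)) = (\<Sum>m\<in>{m\<in>K. m > p}. real (d (m - p)) / real (N m))"
      using that by (intro sum.mono_neutral_cong_right) (auto simp: D_def)
    \<comment> \<open>Monotonicity of \<open>d\<close> replaces m - p by m - a, so that k = m - a
      turns the sum into a partial sum of the given series.\<close>
    also have "\<dots> \<le> (\<Sum>m\<in>{m\<in>K. m > p}. real (d (m - a)) / real (N (m - a + a)))"
    proof (intro sum_mono)
      fix m assume "m \<in> {m\<in>K. m > p}"
      then have m: "1 \<le> m - p" "m - p \<le> m - a" "m - a + a = m"
        by (auto simp: p_def)
      then show "real (d (m - p)) / real (N m) \<le> real (d (m - a)) / real (N (m - a + a))"
        using lacunary_mono[OF assms(1) m(1,2)] by (simp add: divide_right_mono)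
    qed
    also have "\<dots> = (\<Sum>k\<in>(\<lambda>m. m - a) ` {m\<in>K. m > p}. real (d k) / real (N (k + a)))"
      by (subst sum.reindex) (auto simp: inj_on_def p_def)
    also have "\<dots> \<le> S"
      unfolding S_def using that by (intro sum_le_suminf assms(3)) auto
    finally show ?thesis .
  qed
  have prod_le: "(\<Prod>m\<in>K. 1 + 2 * pi * real (D m) / real (N m)) \<le> exp (2 * pi * S)" if "finite K" for K
  proof -
    have "(\<Prod>m\<in>K. 1 + 2 * pi * real (D m) / real (N m)) \<le> exp (\<Sum>m\<in>K. 2 * pi * real (D m) / real (N m))"
      by (rule prod_le_exp_sum) auto
    also have "(\<Sum>m\<in>K. 2 * pi * real (D m) / real (N m)) = 2 * pi * (\<Sum>m\<in>K. real (D m) / real (N m))"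
      by (simp add: sum_distrib_left)
    finally show ?thesis
      using sum_le[OF that] by (smt (verit) exp_le_cancel_iff mult_left_mono pi_gt_zero)
  qed
  have "ind_norm \<phi> n / C \<le> L1_l2_norm \<phi> n \<and> L1_l2_norm \<phi> n \<le> C * ind_norm \<phi> n"
    if \<phi>: "\<forall>k\<in>{1..n}. trig_poly_H1 (d k) (\<phi> k) \<and> (\<forall>t. \<phi> k (t + 2 * pi / real (N k)) = \<phi> k t)"
    for n and \<phi> :: "nat \<Rightarrow> real \<Rightarrow> complex"
  proof -
    let ?PiM = "\<lambda>K. PiM K (\<lambda>_ :: nat. torus_measure)"
    define J where "J K = (\<integral>\<^sup>+t. ennreal (sqrt (\<Sum>k\<in>K. (cmod (\<phi> k t))\<^sup>2)) \<partial>torus_measure)" for K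
    define I where "I K = (\<integral>\<^sup>+t. ennreal (sqrt (\<Sum>k\<in>K. (cmod (\<phi> k (t k)))\<^sup>2)) \<partial>?PiM K)" for K
    define A where "A r = {k\<in>{1..n}. k mod p = r}" for r
    have meas: "\<phi> k \<in> borel_measurable borel" if "k \<in> {1..n}" for k
      using \<phi> that by (blast intro: trig_poly_H1_measurable)
    note [measurable] = meas
    \<comment> \<open>The coordinates outside \<open>K\<close> integrate to 1. Integrals for
      different index sets thus live on one space and can be compared pointwise.\<close>
    have I_restrict: "I K = (\<integral>\<^sup>+t. ennreal (sqrt (\<Sum>k\<in>K. (cmod (\<phi> k (t k)))\<^sup>2)) \<partial>?PiM {1..n})"
      if "K \<subseteq> {1..n}" for K
    proof -
      have [measurable]: "\<phi> k \<in> borel_measurable borel" if "k \<in> K" for k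
        using meas \<open>K \<subseteq> {1..n}\<close> that by auto
      have "I K = (\<integral>\<^sup>+t. ennreal (sqrt (\<Sum>k\<in>K. (cmod (\<phi> k (restrict t K k)))\<^sup>2)) \<partial>?PiM {1..n})"
        unfolding I_def
        by (subst torus_product.distr_restrict[OF that finite_atLeastAtMost],
            rule nn_integral_distr, rule measurable_restrict_subset[OF that]) measurable
      then show ?thesis
        by simp
    qed
    have classes: "ennreal (sqrt (\<Sum>k\<in>{1..n}. f k)) \<le> (\<Sum>r<p. ennreal (sqrt (\<Sum>k\<in>A r. f k)))"
      if "\<And>k. f k \<ge> 0" for f :: "nat \<Rightarrow> real"
    proof -
      have "sqrt (\<Sum>k\<in>{1..n}. f k) \<le> (\<Sum>r<p. sqrt (\<Sum>k\<in>A r. f k))"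
        unfolding A_def by (rule sqrt_sum_le_sum_fibres) (use that in \<open>auto simp: p_def\<close>)
      then show ?thesis
        using that by (simp add: ennreal_leI sum_nonneg)
    qed
    have class_equiv: "J (A r) \<le> ennreal (exp (2 * pi * S)) * I (A r)"
      "I (A r) \<le> ennreal (exp (2 * pi * S)) * J (A r)" for r
    proof -
      let ?c = "ennreal (\<Prod>m\<in>A r. 1 + 2 * pi * real (D m) / real (N m))"
      have poly: "trig_poly_H1 (D m) (\<phi> i)" if "i \<in> A r" "m \<in> A r" "i < m" for i m
      proof -
        \<comment> \<open>Distinct members of a residue class differ by at least \<open>p\<close>,
          so the degree of the earlier one is bounded by \<open>D m\<close>.\<close>
        have "p dvd m - i"
          using that by (metis (mono_tags, lifting) A_def mem_Collect_eq mod_eq_dvd_iff_nat less_imp_le)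
        then have "p \<le> m - i"
          using that by (intro dvd_imp_le) auto
        then have "m > p" "i \<le> m - p" "i \<ge> 1"
          using that by (auto simp: A_def)
        then show ?thesis
          using \<phi> that lacunary_mono[OF assms(1), of i "m - p"]
          by (auto simp: D_def A_def intro: trig_poly_H1_mono)
      qed
      have "J (A r) \<le> ?c * I (A r) \<and> I (A r) \<le> ?c * J (A r)"
        using diagonal_equiv_independent[of "A r" 0 N \<phi> D] \<phi> assms(2) meas poly
        unfolding J_def I_def by (auto simp: A_def)
      moreover have "?c \<le> ennreal (exp (2 * pi * S))"
        by (intro ennreal_leI prod_le) (auto simp: A_def)
      ultimately show "J (A r) \<le> ennreal (exp (2 * pi * S)) * I (A r)"
        "I (A r) \<le> ennreal (exp (2 * pi * S)) * J (A r)"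
        by (meson mult_right_mono order_trans zero_le)+
    qed
    have J_sum: "J {1..n} \<le> (\<Sum>r<p. J (A r))"
    proof -
      have [measurable]: "\<phi> k \<in> borel_measurable borel" if "k \<in> A r" for k r
        using meas that by (auto simp: A_def)
      have "J {1..n} \<le> (\<integral>\<^sup>+t. (\<Sum>r<p. ennreal (sqrt (\<Sum>k\<in>A r. (cmod (\<phi> k t))\<^sup>2))) \<partial>torus_measure)"
        unfolding J_def by (intro nn_integral_mono classes) simp
      also have "\<dots> = (\<Sum>r<p. J (A r))"
        unfolding J_def by (rule nn_integral_sum) measurable
      finally show ?thesis .
    qed
    have I_sum: "I {1..n} \<le> (\<Sum>r<p. I (A r))"
    proof -
      have "A r \<subseteq> {1..n}" for r
        by (auto simp: A_def)
      note IA = I_restrict[OF this]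
      have [measurable]: "\<phi> k \<in> borel_measurable borel" if "k \<in> A r" for k r
        using meas that by (auto simp: A_def)
      have [measurable]: "(\<lambda>t. t k) \<in> borel_measurable (?PiM {1..n})" if "k \<in> A r" for k r
      proof -
        have "k \<in> {1..n}"
          using that by (auto simp: A_def)
        then show ?thesis by measurable
      qed
      have "I {1..n} \<le> (\<integral>\<^sup>+t. (\<Sum>r<p. ennreal (sqrt (\<Sum>k\<in>A r. (cmod (\<phi> k (t k)))\<^sup>2))) \<partial>?PiM {1..n})"
        unfolding I_def by (intro nn_integral_mono classes) simp
      also have "\<dots> = (\<Sum>r<p. I (A r))"
        unfolding IA by (rule nn_integral_sum) measurable
      finally show ?thesis .
    qed
    have J_mono: "J (A r) \<le> J {1..n}" and I_mono: "I (A r) \<le> I {1..n}" for r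
    proof -
      have A: "A r \<subseteq> {1..n}"
        by (auto simp: A_def)
      show "J (A r) \<le> J {1..n}"
        unfolding J_def using A
        by (intro nn_integral_mono ennreal_leI real_sqrt_le_mono sum_mono2) auto
      show "I (A r) \<le> I {1..n}"
        unfolding I_restrict[OF A] I_restrict[OF order_refl] using A
        by (intro nn_integral_mono ennreal_leI real_sqrt_le_mono sum_mono2) auto
    qed
    have C: "(\<Sum>r<p. ennreal (exp (2 * pi * S)) * x) = ennreal C * x" for x
      by (simp add: C_def ennreal_mult ennreal_of_nat_eq_real_of_nat mult.assoc)
    \<comment> \<open>The full norm is at most the sum of its class norms; each class norm is
      exchanged for the other kind and then enlarged to the full norm of that kind.\<close>
    have "J {1..n} \<le> (\<Sum>r<p. ennreal (exp (2 * pi * S)) * I {1..n})"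
      by (intro order_trans[OF J_sum] sum_mono order_trans[OF class_equiv(1)] mult_left_mono I_mono) auto
    moreover have "I {1..n} \<le> (\<Sum>r<p. ennreal (exp (2 * pi * S)) * J {1..n})"
      by (intro order_trans[OF I_sum] sum_mono order_trans[OF class_equiv(2)] mult_left_mono J_mono) auto
    \<comment> \<open>The identity also covers an infinite integral: the Bochner integral and
      \<open>enn2real\<close> both give 0 then.\<close>
    moreover have "L1_l2_norm \<phi> n = enn2real (J {1..n})"
      unfolding L1_l2_norm_def J_def by (rule integral_eq_nn_integral) (auto simp: sum_nonneg)
    moreover have "ind_norm \<phi> n = enn2real (I {1..n})"
      unfolding ind_norm_def I_def by (rule integral_eq_nn_integral) (auto simp: sum_nonneg)
    ultimately show ?thesis
      using enn2real_equiv[OF _ _ \<open>C \<ge> 1\<close>] unfolding C by auto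
  qed
  then show ?thesis
    using \<open>C \<ge> 1\<close> by blast
qed

end
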